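(* Let $X$ be a finite topological $T_0$-space. Then $D(X)=\emptyset$ if and only if $S_F(X)=1$.
   Context: For a finite topological $T_0$-space $X$ and $x\in X$, $U_x$ is the intersection of all open sets containing $x$. The relation $x\leq y \iff U_x\subseteq U_y$ is a partial order on $X$, so $U_x=\{y: y\le x\}$; open sets are exactly the lower sets. A point $x\in X$ is a down beat point if $U_x\setminus\{x\}$ has a maximum. $D(X)$ denotes the set of down beat points of $X$. $\mathbb{R}_0^+$ is the set of non-negative real numbers with the usual topology. A semiflow on $X$ is a continuous map $\varphi:\mathbb{R}_0^+\times X\to X$ (product topology on the domain) such that $\varphi(0,x)=x$ for all $x\in X$ and $\varphi(s,\varphi(t,x))=\varphi(s+t,x)$ for all $x\in X$, $s,t\in\mathbb{R}_0^+$. $S_F(X)$ denotes the number of distinct semiflows on $X$ (including the trivial one, $\varphi(t,x)=x$). *)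

theory Defs
  imports "HOL-Analysis.Analysis" "HOL-Library.Extended_Nat"
begin

definition min_open :: "'a topology \<Rightarrow> 'a \<Rightarrow> 'a set" where
  "min_open X x = \<Inter>{U. openin X U \<and> x \<in> U}"

text \<open>With this convention the open sets of a finite space are its lower sets
  (the order is the reverse of the other common one).\<close>

definition point_le :: "'a topology \<Rightarrow> 'a \<Rightarrow> 'a \<Rightarrow> bool" where
  "point_le X x y \<longleftrightarrow> x \<in> topspace X \<and> y \<in> topspace X \<and> min_open X x \<subseteq> min_open X y"

definition down_beat_points :: "'a topology \<Rightarrow> 'a set" where
  "down_beat_points X =
    {x \<in> topspace X. \<exists>m \<in> min_open X x - {x}. \<forall>y \<in> min_open X x - {x}. point_le X y m}"

text \<open>A map on a subset of a HOL type is represented by a function that is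
  \<open>undefined\<close> outside its domain (\<open>extensional\<close>), so that maps which agree on
  \<open>{0..} \<times> topspace X\<close> are equal and are counted only once.\<close>

definition semiflows :: "'a topology \<Rightarrow> (real \<times> 'a \<Rightarrow> 'a) set" where
  "semiflows X = {\<phi> \<in> extensional ({0..} \<times> topspace X).
     continuous_map (prod_topology (top_of_set {0..}) X) X \<phi> \<and>
     (\<forall>x \<in> topspace X. \<phi> (0, x) = x) \<and>
     (\<forall>x \<in> topspace X. \<forall>s \<ge> 0. \<forall>t \<ge> 0. \<phi> (s, \<phi> (t, x)) = \<phi> (s + t, x))}"

text \<open>The explicit \<open>\<infinity>\<close> is there because \<open>card\<close> of an infinite set is \<open>0\<close>.\<close>

definition num_semiflows :: "'a topology \<Rightarrow> enat" where
  "num_semiflows X = (if finite (semiflows X) then enat (card (semiflows X)) else \<infinity>)"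

end

theory Submission
  imports Defs
begin

text \<open>For small \<open>t\<close> a semiflow satisfies \<open>\<phi> (t, x) \<le> x\<close> for every \<open>x\<close>. If a continuous map
  \<open>f\<close> lies below the identity and \<open>x\<close> is a minimal point that it moves, then every \<open>y < x\<close>
  satisfies \<open>y = f y \<le> f x < x\<close>, so \<open>x\<close> is a down beat point. Without down beat points
  the semiflow is therefore trivial for small times, hence for all times. Conversely, a down beat
  point can jump at time \<open>0\<close> to the maximum of the points strictly below it.\<close>

lemma min_open_subset: "openin X U \<Longrightarrow> x \<in> U \<Longrightarrow> min_open X x \<subseteq> U"
  unfolding min_open_def by blast

lemma mem_min_open: "x \<in> min_open X x"
  unfolding min_open_def by blast

lemma openin_min_open:
  assumes "finite (topspace X)" "x \<in> topspace X"
  shows "openin X (min_open X x)"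
  unfolding min_open_def
proof (rule openin_Inter)
  have "{U. openin X U \<and> x \<in> U} \<subseteq> Pow (topspace X)"
    by (auto dest: openin_subset)
  then show "finite {U. openin X U \<and> x \<in> U}"
    using assms(1) by (meson finite_Pow_iff finite_subset)
  show "{U. openin X U \<and> x \<in> U} \<noteq> {}"
    using assms(2) by blast
qed auto

lemma min_open_subset_topspace: "x \<in> topspace X \<Longrightarrow> min_open X x \<subseteq> topspace X"
  by (rule min_open_subset) auto

lemma point_le_iff_mem_min_open:
  assumes "finite (topspace X)" "y \<in> topspace X"
  shows "point_le X x y \<longleftrightarrow> x \<in> min_open X y"
  using assms mem_min_open[of x X] openin_min_open[of X y] min_open_subset[of X "min_open X y" x]
    min_open_subset_topspace[of y X]
  unfolding point_le_def by blast

text \<open>An open set separating the two points would contain the minimal open set of one of them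
  and miss the other point.\<close>

lemma min_open_antisym:
  assumes "t0_space X" "x \<in> topspace X" "y \<in> topspace X"
    and "x \<in> min_open X y" "y \<in> min_open X x"
  shows "x = y"
  using assms unfolding t0_space_def min_open_def by blast

text \<open>The preimage of \<open>min_open Y (f x)\<close> is an open set around \<open>x\<close>.
  In order terms, continuous maps are monotone.\<close>

lemma continuous_map_min_open:
  assumes "finite (topspace X)" "finite (topspace Y)" "continuous_map X Y f"
    and "x \<in> topspace X" "y \<in> min_open X x"
  shows "f y \<in> min_open Y (f x)"
proof -
  have "f x \<in> topspace Y"
    using assms(3,4) by (auto simp: continuous_map_def)
  then have "openin X {z \<in> topspace X. f z \<in> min_open Y (f x)}"
    using openin_continuous_map_preimage[OF assms(3) openin_min_open[OF assms(2)]] by blast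
  from min_open_subset[OF this, of x] show ?thesis
    using assms(4,5) mem_min_open[of "f x" Y] by blast
qed

lemma continuous_map_below_identity_eq:
  assumes fin: "finite (topspace X)" and t0: "t0_space X"
    and no_beat: "down_beat_points X = {}"
    and cont: "continuous_map X X f"
    and below: "\<And>x. x \<in> topspace X \<Longrightarrow> f x \<in> min_open X x"
    and "x \<in> topspace X"
  shows "f x = x"
  using assms(6)
\<comment> \<open>The size of the down-set serves as rank: it drops strictly on passing to a
  strictly smaller point.\<close>
proof (induction "card (min_open X x)" arbitrary: x rule: less_induct)
  case less
  have sub: "min_open X x \<subseteq> topspace X"
    using less.prems by (rule min_open_subset_topspace)
  have IH: "f y = y" if "y \<in> min_open X x - {x}" for y
  proof (rule less.hyps)
    show y: "y \<in> topspace X" using that sub by blast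
    have "min_open X y \<subseteq> min_open X x"
      using that openin_min_open[OF fin less.prems] by (intro min_open_subset) auto
    moreover have "x \<notin> min_open X y"
      using that min_open_antisym[OF t0 less.prems y] by blast
    ultimately have "min_open X y \<subset> min_open X x"
      using mem_min_open[of x X] by blast
    then show "card (min_open X y) < card (min_open X x)"
      using sub fin by (meson finite_subset psubset_card_mono)
  qed
  have fx: "f x \<in> topspace X" using below[OF less.prems] sub by blast
  \<comment> \<open>Monotonicity and \<open>f y = y\<close> put \<open>y\<close> below
    \<open>f x\<close>. Since \<open>f x\<close> itself lies in \<open>min_open X x\<close>, it
    would be the excluded maximum if it differed from \<open>x\<close>.\<close>
  have "point_le X y (f x)" if "y \<in> min_open X x - {x}" for y
    using continuous_map_min_open[OF fin fin cont less.prems, of y] that IH[OF that]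
      point_le_iff_mem_min_open[OF fin fx] by auto
  then show "f x = x"
    using no_beat less.prems below[OF less.prems] unfolding down_beat_points_def by blast
qed

definition trivial_semiflow :: "'a topology \<Rightarrow> real \<times> 'a \<Rightarrow> 'a" where
  "trivial_semiflow X = restrict snd ({0..} \<times> topspace X)"

lemma trivial_semiflow_mem: "trivial_semiflow X \<in> semiflows X"
proof -
  have "continuous_map (prod_topology (top_of_set {0..}) X) X (trivial_semiflow X)"
    unfolding trivial_semiflow_def
    by (rule continuous_map_eq[OF continuous_map_snd]) auto
  then show ?thesis
    unfolding semiflows_def by (auto simp: trivial_semiflow_def)
qed

text \<open>The trivial semiflow is always counted, so only the absence of others matters; an
  infinite set gives \<infinity>, which is not 1.\<close>

lemma num_semiflows_eq_1_iff: "num_semiflows X = 1 \<longleftrightarrow> semiflows X \<subseteq> {trivial_semiflow X}"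
proof
  assume "num_semiflows X = 1"
  then have "card (semiflows X) = 1"
    unfolding num_semiflows_def by (auto simp: one_enat_def split: if_splits)
  then show "semiflows X \<subseteq> {trivial_semiflow X}"
    using trivial_semiflow_mem[of X] by (auto simp: card_1_singleton_iff)
next
  assume "semiflows X \<subseteq> {trivial_semiflow X}"
  then have "semiflows X = {trivial_semiflow X}"
    using trivial_semiflow_mem[of X] by blast
  then show "num_semiflows X = 1"
    unfolding num_semiflows_def by (simp add: one_enat_def)
qed

text \<open>Continuity at \<open>(0, x)\<close>, where the value is \<open>x\<close>, sends a box
  around that point into the neighbourhood \<open>min_open X x\<close>. Finitely many points then
  share one time bound.\<close>

lemma semiflow_eventually_below:
  assumes fin: "finite (topspace X)" and \<phi>: "\<phi> \<in> semiflows X"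
  shows "eventually (\<lambda>t. \<forall>x\<in>topspace X. \<phi> (t, x) \<in> min_open X x) (at_right 0)"
proof (rule eventually_ball_finite[OF fin], rule ballI)
  fix x assume x: "x \<in> topspace X"
  let ?P = "prod_topology (top_of_set {0::real..}) X"
  let ?W = "{p \<in> topspace ?P. \<phi> p \<in> min_open X x}"
  have "openin ?P ?W"
    using \<phi> openin_min_open[OF fin x] unfolding semiflows_def
    by (intro openin_continuous_map_preimage) auto
  moreover have "(0, x) \<in> ?W"
    using x \<phi> mem_min_open[of x X] by (auto simp: semiflows_def)
  ultimately obtain T V where T: "openin (top_of_set {0..}) T" "0 \<in> T"
    and V: "x \<in> V" "T \<times> V \<subseteq> ?W"
    unfolding openin_prod_topology_alt by meson
  from T obtain e where e: "e > 0" "ball 0 e \<inter> {0..} \<subseteq> T"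
    unfolding openin_contains_ball by blast
  have "\<phi> (t, x) \<in> min_open X x" if "0 < t" "t < e" for t
  proof -
    have "t \<in> T" using e(2) that by (auto simp: dist_norm)
    then show ?thesis using V by blast
  qed
  then show "eventually (\<lambda>t. \<phi> (t, x) \<in> min_open X x) (at_right 0)"
    unfolding eventually_at_right_field using e(1) by blast
qed

lemma continuous_map_semiflow_slice:
  assumes "\<phi> \<in> semiflows X" "t \<ge> 0"
  shows "continuous_map X X (\<lambda>x. \<phi> (t, x))"
proof -
  have "continuous_map X (prod_topology (top_of_set {0..}) X) (\<lambda>x. (t, x))"
    using assms(2) by (auto simp: continuous_map_pairwise o_def)
  then show ?thesis
    using continuous_map_compose[of X _ "\<lambda>x. (t, x)" X \<phi>] assms(1)
    by (auto simp: semiflows_def o_def)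
qed

text \<open>Every time is a multiple of arbitrarily small ones, so this carries triviality from
  small times to all times.\<close>

lemma semiflow_multiple:
  assumes "\<phi> \<in> semiflows X" "s \<ge> 0" "x \<in> topspace X" "\<phi> (s, x) = x"
  shows "\<phi> (real n * s, x) = x"
proof (induction n)
  case 0
  then show ?case using assms by (simp add: semiflows_def)
next
  case (Suc n)
  have "\<phi> (real n * s + s, x) = \<phi> (real n * s, \<phi> (s, x))"
    using assms(1-3) unfolding semiflows_def by auto
  then show ?case using Suc assms(4) by (simp add: algebra_simps)
qed

lemma semiflow_trivial:
  assumes fin: "finite (topspace X)" and t0: "t0_space X"
    and no_beat: "down_beat_points X = {}" and \<phi>: "\<phi> \<in> semiflows X"
  shows "\<phi> = trivial_semiflow X"
proof -
  obtain e where e: "e > 0"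
    and below: "\<And>t x. 0 < t \<Longrightarrow> t < e \<Longrightarrow> x \<in> topspace X \<Longrightarrow> \<phi> (t, x) \<in> min_open X x"
    using semiflow_eventually_below[OF fin \<phi>] unfolding eventually_at_right_field by blast
  have small: "\<phi> (t, x) = x" if "0 < t" "t < e" "x \<in> topspace X" for t x
    using continuous_map_below_identity_eq[OF fin t0 no_beat continuous_map_semiflow_slice[OF \<phi>], of t x]
      below that by auto
  have "\<phi> (t, x) = x" if "t \<ge> 0" "x \<in> topspace X" for t x
  proof (cases "t = 0")
    case True
    then show ?thesis using \<phi> that by (simp add: semiflows_def)
  next
    case False
    then have t: "t > 0" using that by simp
    \<comment> \<open>Cutting \<open>t\<close> into more than \<open>t / e\<close> equal steps makes
      each step shorter than \<open>e\<close>.\<close>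
    obtain n where n: "t / e < real n" using reals_Archimedean2 by blast
    have "real n > 0" using n t e by (meson divide_pos_pos less_trans)
    then have "\<phi> (t / real n, x) = x"
      using n t e that(2) by (intro small) (auto simp: field_simps)
    from semiflow_multiple[OF \<phi> _ that(2) this, of n] show ?thesis
      using t \<open>real n > 0\<close> by simp
  qed
  moreover have "\<phi> \<in> extensional ({0..} \<times> topspace X)"
    using \<phi> by (simp add: semiflows_def)
  ultimately show ?thesis
    unfolding trivial_semiflow_def by (intro extensionalityI[of \<phi>]) auto
qed

text \<open>The jump cannot be delayed: a point fixed at some positive time is fixed at all its
  multiples. The strict \<open>t > 0\<close> keeps the initial condition at time 0.\<close>

definition jump_semiflow :: "'a topology \<Rightarrow> 'a \<Rightarrow> 'a \<Rightarrow> real \<times> 'a \<Rightarrow> 'a" where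
  "jump_semiflow X x m =
    restrict (\<lambda>(t, y). if y = x \<and> t > 0 then m else y) ({0..} \<times> topspace X)"

lemma jump_semiflow_mem:
  assumes fin: "finite (topspace X)" and x: "x \<in> topspace X"
    and m: "m \<in> min_open X x - {x}"
    and max: "\<And>y. y \<in> min_open X x - {x} \<Longrightarrow> point_le X y m"
  shows "jump_semiflow X x m \<in> semiflows X"
proof -
  have mX: "m \<in> topspace X" using m min_open_subset_topspace[OF x] by blast
  let ?P = "prod_topology (top_of_set {0::real..}) X"
  have "continuous_map ?P X (jump_semiflow X x m)"
    unfolding continuous_map_def
  proof (intro conjI allI impI)
    show "jump_semiflow X x m \<in> topspace ?P \<rightarrow> topspace X"
      using mX by (auto simp: jump_semiflow_def)
    fix U assume U: "openin X U"
    have UX: "U \<subseteq> topspace X" using U by (rule openin_subset)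
    let ?W = "{p \<in> topspace ?P. jump_semiflow X x m p \<in> U}"
    show "openin ?P ?W"
    proof (cases "m \<in> U")
      case False
      \<comment> \<open>\<open>U\<close> is a lower set and \<open>m\<close> lies below
        \<open>x\<close>. So neither end of the jump is in \<open>U\<close>, and all points of
        \<open>U\<close> stay put.\<close>
      then have "x \<notin> U" using m min_open_subset[OF U] by blast
      then have "?W = {0..} \<times> U"
        using UX False by (auto simp: jump_semiflow_def split: if_splits)
      then show ?thesis using U by (simp add: openin_prod_Times_iff)
    next
      case True
      \<comment> \<open>Here maximality of \<open>m\<close> is essential: all points strictly below
        \<open>x\<close> lie below \<open>m\<close>, hence in \<open>U\<close>. The possibly missing
        preimage points \<open>(t, x)\<close> with \<open>t > 0\<close> thus have the open box
        \<open>{0<..} \<times> min_open X x\<close> around them inside the preimage.\<close>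
      have "min_open X x - {x} \<subseteq> U"
        using max point_le_iff_mem_min_open[OF fin mX] min_open_subset[OF U True] by blast
      then have "?W = {0..} \<times> U \<union> {0<..} \<times> min_open X x"
        using UX x True mem_min_open[of x X] min_open_subset_topspace[OF x]
        by (auto simp: jump_semiflow_def split: if_splits)
      moreover have "openin (top_of_set {0..}) {0::real<..}"
        by (rule open_subset) auto
      ultimately show ?thesis
        using U openin_min_open[OF fin x]
        by (auto intro!: openin_Un simp: openin_prod_Times_iff)
    qed
  qed
  \<comment> \<open>The semigroup law holds because \<open>m \<noteq> x\<close>: after the jump the
    point rests at \<open>m\<close>.\<close>
  then show ?thesis
    using m mX unfolding semiflows_def by (auto simp: jump_semiflow_def)
qed

lemma jump_semiflow_nontrivial:
  assumes "x \<in> topspace X" "m \<noteq> x"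
  shows "jump_semiflow X x m \<noteq> trivial_semiflow X"
proof
  assume "jump_semiflow X x m = trivial_semiflow X"
  from fun_cong[OF this, of "(1, x)"] show False
    using assms by (simp add: jump_semiflow_def trivial_semiflow_def)
qed

theorem theorem4p1:
  fixes X :: "'a topology"
  assumes "finite (topspace X)" and "t0_space X"
  shows "down_beat_points X = {} \<longleftrightarrow> num_semiflows X = 1"
proof
  assume "down_beat_points X = {}"
  then show "num_semiflows X = 1"
    using semiflow_trivial[OF assms] by (auto simp: num_semiflows_eq_1_iff)
next
  assume one: "num_semiflows X = 1"
  show "down_beat_points X = {}"
  proof (rule ccontr)
    assume "down_beat_points X \<noteq> {}"
    then obtain x m where x: "x \<in> topspace X" and m: "m \<in> min_open X x - {x}"
      and max: "\<forall>y \<in> min_open X x - {x}. point_le X y m"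
      unfolding down_beat_points_def by blast
    have "jump_semiflow X x m \<in> semiflows X"
      using jump_semiflow_mem[OF assms(1) x m] max by blast
    then show False
      using one m jump_semiflow_nontrivial[OF x, of m] by (auto simp: num_semiflows_eq_1_iff)
  qed
qed

end
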